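(* Let $\phi\in C(\partial\Omega\times\partial\Omega)$, let $\mu = k^2\sup_{x\in\Omega}\int_\Omega |G(x,y)|\,dy$, write $\|u_0\|=\|u_0\|_{C(\overline\Omega\times\partial\Omega)}$, and let $\|\mathcal{K}_1\|$ be the operator norm of $\mathcal{K}_1: C(\partial\Omega\times\partial\Omega)\to L^\infty(\Omega)$. Set $$C=\max\Big\{2,\ \frac{81}{8}\,\mu\,\|\mathcal{K}_1\|\,\|u_0\|^3\Big\},\qquad r=\frac{2}{27\mu\|u_0\|^2}\Big[\sqrt{16C^2+1}-4C\Big].$$ If $\|\mathcal{K}_1\phi\|_\infty<r$, then the inverse Born series $$\tilde\beta=\sum_{m=1}^\infty\mathcal{K}_m(\phi)$$ converges (in $L^\infty(\Omega)$).
   Context: Setting. $\Omega\subset\mathbb{R}^d$, $d\ge 2$, is a bounded domain with smooth boundary, and $k$ is real such that $-k^2$ is not a Neumann eigenvalue of the Laplacian on $\Omega$. $G$ is the Neumann Green's function: $\Delta_x G(x,y)+k^2G(x,y)=\delta(x-y)$ in $\Omega$ with zero normal derivative on $\partial\Omega$. The nonlinear problem is $\Delta u+k^2u+k^2\beta u^3=0$ in $\Omega$, $\partial u/\partial\nu=g$ on $\partial\Omega$ (here $\partial/\partial\nu$ is the outward normal derivative), with $\beta\in L^\infty(\Omega)$ real valued. A family of real sources $g=g_s$ indexed by $s\in\partial\Omega$ is used; $u_0(\cdot,s)$ is the solution of the linear problem $\Delta u_0+k^2u_0=0$ in $\Omega$, $\partial u_0/\partial\nu=g_s$ on $\partial\Omega$,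 and $u_0$ is viewed as a function in $C(\overline\Omega\times\partial\Omega)$, not identically zero. Forward operators. For $v\in C(\overline\Omega\times\partial\Omega)$ and $\beta\in L^\infty(\Omega)$ put $b(v,\beta)(x,s)=-k^2\int_\Omega G(x,y)\beta(y)v(y,s)\,dy$. For a multilinear operator $T_l$ of order $l$ (with values in functions of $(x,s)$), $BT_l$ is the multilinear operator of order $l+1$ given by $BT_l(\beta_1,\dots,\beta_{l+1})=b(T_l(\beta_1,\dots,\beta_l),\beta_{l+1})$. For multilinear $T_l,T_j$ of orders $l,j$, $T_l\otimes T_j(\beta_1,\dots,\beta_{l+j})=T_l(\beta_1,\dots,\beta_l)\,T_j(\beta_{l+1},\dots,\beta_{l+j})$ (pointwise product). The operators $K_n$ (multilinear of order $n$) are defined by $K_0=u_0$ and, for $n\ge0$, $$K_{n+1}=B\sum_{\substack{i_1+i_2+i_3=n\\ 0\le i_1,i_2,i_3\le n}}K_{i_1}\otimes K_{i_2}\otimes K_{i_3}.$$ After the recursion, $K_n(\beta_1,\dots,\beta_n)$ is restricted to $\partial\Omega\times\partial\Omega$, so $K_n:[L^\infty(\Omega)]^n\to C(\partial\Omega\times\partial\Omega)$. Inverse operators. $\mathcal{K}_1=K_1^+$ is some fixed regularized pseudoinverse of $K_1$, a bounded linear operator $C(\partial\Omega\times\partial\Omega)\to L^\infty(\Omega)$ (no further property of it is specified). For $m\ge2$, $$\mathcal{K}_m(\phi)=-\sum_{n=2}^m\ \sum_{\substack{i_1+\cdots+i_n=m\\ i_j\ge1}}\mathcal{K}_1K_n\big(\mathcal{K}_{i_1}(\phi),\dots,\mathcal{K}_{i_n}(\phi)\big).$$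 All $C(\cdot)$ norms are sup norms. *)

theory Defs
  imports "HOL-Analysis.Analysis" "HOL-Probability.Essential_Supremum"
begin

section \<open>Smooth domains and the Neumann problem\<close>

text \<open>\<open>Ck_on n S f\<close>: all iterated directional derivatives of \<open>f\<close> up to order \<open>n\<close> exist
  (as Frechet derivatives) and are continuous on the open set \<open>S\<close>.\<close>

primrec Ck_on :: "nat \<Rightarrow> 'a::euclidean_space set \<Rightarrow> ('a \<Rightarrow> real) \<Rightarrow> bool" where
  "Ck_on 0 S f \<longleftrightarrow> continuous_on S f"
| "Ck_on (Suc n) S f \<longleftrightarrow> (\<forall>x\<in>S. f differentiable (at x)) \<and>
     (\<forall>v. Ck_on n S (\<lambda>x. frechet_derivative f (at x) v))"

definition smooth_on :: "'a::euclidean_space set \<Rightarrow> ('a \<Rightarrow> real) \<Rightarrow> bool" where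
  "smooth_on S f \<longleftrightarrow> (\<forall>n. Ck_on n S f)"

definition laplacian :: "('a::euclidean_space \<Rightarrow> real) \<Rightarrow> 'a \<Rightarrow> real" where
  "laplacian f x =
     (\<Sum>e\<in>Basis. frechet_derivative (\<lambda>y. frechet_derivative f (at y) e) (at x) e)"

text \<open>A local defining function \<open>\<rho>\<close> of \<open>\<Omega>\<close> near \<open>p\<close>. Since the gradient does not vanish, the
  boundary of \<open>\<Omega>\<close> in \<open>U\<close> is \<open>{\<rho> = 0}\<close> and \<open>\<Omega>\<close> lies on one side of it.\<close>

definition local_defining_function ::
    "'a::euclidean_space set \<Rightarrow> 'a \<Rightarrow> 'a set \<Rightarrow> ('a \<Rightarrow> real) \<Rightarrow> bool" where
  "local_defining_function \<Omega> p U \<rho> \<longleftrightarrow> open U \<and> p \<in> U \<and> smooth_on U \<rho> \<and>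
     (\<forall>x\<in>U. \<exists>D. D \<noteq> 0 \<and> GDERIV \<rho> x :> D) \<and> \<Omega> \<inter> U = {x \<in> U. \<rho> x < 0}"

definition smooth_bounded_domain :: "'a::euclidean_space set \<Rightarrow> bool" where
  "smooth_bounded_domain \<Omega> \<longleftrightarrow> open \<Omega> \<and> connected \<Omega> \<and> \<Omega> \<noteq> {} \<and> bounded \<Omega> \<and>
     (\<forall>p\<in>frontier \<Omega>. \<exists>U \<rho>. local_defining_function \<Omega> p U \<rho>)"

definition outward_normal :: "'a::euclidean_space set \<Rightarrow> 'a \<Rightarrow> 'a \<Rightarrow> bool" where
  "outward_normal \<Omega> p \<nu> \<longleftrightarrow> norm \<nu> = 1 \<and>
     (\<exists>U \<rho> c. local_defining_function \<Omega> p U \<rho> \<and> c > 0 \<and> GDERIV \<rho> p :> c *\<^sub>R \<nu>)"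

text \<open>The outward normal derivative at a boundary point \<open>p\<close> is the one-sided derivative along
  the normal line from inside, so that only the values of \<open>u\<close> on the closure of \<open>\<Omega>\<close> matter.\<close>

definition has_normal_derivative ::
    "'a::euclidean_space set \<Rightarrow> ('a \<Rightarrow> real) \<Rightarrow> 'a \<Rightarrow> real \<Rightarrow> bool" where
  "has_normal_derivative \<Omega> u p h \<longleftrightarrow>
     (\<forall>\<nu>. outward_normal \<Omega> p \<nu> \<longrightarrow>
        ((\<lambda>t. u (p + t *\<^sub>R \<nu>)) has_real_derivative h) (at_left 0))"

text \<open>Classical solutions of \<open>\<Delta>u = \<lambda>u\<close> in \<open>\<Omega>\<close>, \<open>\<partial>u/\<partial>\<nu> = h\<close> on the boundary.\<close>

definition neumann_solution ::
    "'a::euclidean_space set \<Rightarrow> real \<Rightarrow> ('a \<Rightarrow> real) \<Rightarrow> ('a \<Rightarrow> real) \<Rightarrow> bool" where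
  "neumann_solution \<Omega> l h u \<longleftrightarrow> continuous_on (closure \<Omega>) u \<and> Ck_on 2 \<Omega> u \<and>
     (\<forall>x\<in>\<Omega>. laplacian u x = l * u x) \<and>
     (\<forall>p\<in>frontier \<Omega>. has_normal_derivative \<Omega> u p (h p))"

definition neumann_eigenvalue :: "'a::euclidean_space set \<Rightarrow> real \<Rightarrow> bool" where
  "neumann_eigenvalue \<Omega> l \<longleftrightarrow> (\<exists>u. neumann_solution \<Omega> l (\<lambda>_. 0) u \<and> (\<exists>x\<in>\<Omega>. u x \<noteq> 0))"

definition test_function :: "'a::euclidean_space set \<Rightarrow> ('a \<Rightarrow> real) \<Rightarrow> bool" where
  "test_function \<Omega> \<psi> \<longleftrightarrow> smooth_on UNIV \<psi> \<and>
     (\<exists>S. compact S \<and> S \<subseteq> \<Omega> \<and> (\<forall>x. x \<notin> S \<longrightarrow> \<psi> x = 0))"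

text \<open>\<open>\<Delta>\<^sub>x G(x,y) + k\<^sup>2 G(x,y) = \<delta>(x-y)\<close> in the sense of distributions on \<open>\<Omega>\<close>, with zero normal
  derivative in \<open>x\<close>. The value on the diagonal is irrelevant.\<close>

definition neumann_green ::
    "'a::euclidean_space set \<Rightarrow> real \<Rightarrow> ('a \<Rightarrow> 'a \<Rightarrow> real) \<Rightarrow> bool" where
  "neumann_green \<Omega> k G \<longleftrightarrow> (\<forall>y\<in>\<Omega>.
     integrable (lebesgue_on \<Omega>) (\<lambda>x. G x y) \<and>
     continuous_on (closure \<Omega> - {y}) (\<lambda>x. G x y) \<and>
     (\<forall>\<psi>. test_function \<Omega> \<psi> \<longrightarrow>
        (LINT x|lebesgue_on \<Omega>. G x y * (laplacian \<psi> x + k\<^sup>2 * \<psi> x)) = \<psi> y) \<and>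
     (\<forall>p\<in>frontier \<Omega>. has_normal_derivative \<Omega> (\<lambda>x. G x y) p 0))"


section \<open>The spaces \<open>C(S)\<close> and \<open>L\<^sup>\<infinity>(\<Omega>)\<close>\<close>

text \<open>Elements of \<open>C(S)\<close> are represented by total functions of which only the values on \<open>S\<close>
  matter, elements of \<open>L\<^sup>\<infinity>(\<Omega>)\<close> by functions of which only the class modulo a.e. equality on
  \<open>\<Omega>\<close> matters; \<open>C_norm\<close> and \<open>Linf_norm\<close> are accordingly seminorms on representatives.\<close>

definition C_space :: "'b::topological_space set \<Rightarrow> ('b \<Rightarrow> real) set" where
  "C_space S = {f. continuous_on S f}"

definition C_norm :: "'b::topological_space set \<Rightarrow> ('b \<Rightarrow> real) \<Rightarrow> real" where
  "C_norm S f = (SUP z\<in>S. \<bar>f z\<bar>)"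

definition Linf_space :: "'a::euclidean_space set \<Rightarrow> ('a \<Rightarrow> real) set" where
  "Linf_space \<Omega> = {\<beta>. \<beta> \<in> borel_measurable (lebesgue_on \<Omega>) \<and>
     esssup (lebesgue_on \<Omega>) (\<lambda>x. ereal \<bar>\<beta> x\<bar>) < \<infinity>}"

definition Linf_norm :: "'a::euclidean_space set \<Rightarrow> ('a \<Rightarrow> real) \<Rightarrow> real" where
  "Linf_norm \<Omega> \<beta> = real_of_ereal (esssup (lebesgue_on \<Omega>) (\<lambda>x. ereal \<bar>\<beta> x\<bar>))"

definition bounded_linear_C_Linf :: "'b::topological_space set \<Rightarrow> 'a::euclidean_space set \<Rightarrow>
    (('b \<Rightarrow> real) \<Rightarrow> ('a \<Rightarrow> real)) \<Rightarrow> bool" where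
  "bounded_linear_C_Linf S \<Omega> T \<longleftrightarrow>
     (\<forall>f\<in>C_space S. T f \<in> Linf_space \<Omega>) \<and>
     (\<forall>f\<in>C_space S. \<forall>h\<in>C_space S. AE x in lebesgue_on \<Omega>. T (\<lambda>z. f z + h z) x = T f x + T h x) \<and>
     (\<forall>f\<in>C_space S. \<forall>c. AE x in lebesgue_on \<Omega>. T (\<lambda>z. c * f z) x = c * T f x) \<and>
     (\<exists>M. \<forall>f\<in>C_space S. Linf_norm \<Omega> (T f) \<le> M * C_norm S f)"

definition op_norm :: "'b::topological_space set \<Rightarrow> 'a::euclidean_space set \<Rightarrow>
    (('b \<Rightarrow> real) \<Rightarrow> ('a \<Rightarrow> real)) \<Rightarrow> real" where
  "op_norm S \<Omega> T = (SUP f\<in>{f \<in> C_space S. C_norm S f \<le> 1}. Linf_norm \<Omega> (T f))"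

text \<open>Convergence in \<open>L\<^sup>\<infinity>(\<Omega>)\<close> of the series \<open>\<Sum>m\<ge>1. f m\<close>.\<close>

definition series_converges_Linf :: "'a::euclidean_space set \<Rightarrow> (nat \<Rightarrow> 'a \<Rightarrow> real) \<Rightarrow> bool" where
  "series_converges_Linf \<Omega> f \<longleftrightarrow> (\<exists>\<beta>\<in>Linf_space \<Omega>.
     (\<lambda>N. Linf_norm \<Omega> (\<lambda>x. (\<Sum>m=1..N. f m x) - \<beta> x)) \<longlonglongrightarrow> 0)"


section \<open>Forward operators\<close>

text \<open>An operator of order \<open>l\<close> is a function of the argument list \<open>[\<beta>\<^sub>1, \<dots>, \<beta>\<^sub>l]\<close> with values in
  functions of \<open>(x, s)\<close>; its value on lists of other lengths is irrelevant.\<close>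

type_synonym 'a multi_op = "('a \<Rightarrow> real) list \<Rightarrow> ('a \<times> 'a \<Rightarrow> real)"

definition potential :: "'a::euclidean_space set \<Rightarrow> real \<Rightarrow> ('a \<Rightarrow> 'a \<Rightarrow> real) \<Rightarrow>
    ('a \<times> 'a \<Rightarrow> real) \<Rightarrow> ('a \<Rightarrow> real) \<Rightarrow> ('a \<times> 'a \<Rightarrow> real)" where
  "potential \<Omega> k G v \<beta> = (\<lambda>(x, s). - k\<^sup>2 * (LINT y|lebesgue_on \<Omega>. G x y * \<beta> y * v (y, s)))"

definition B_op :: "'a::euclidean_space set \<Rightarrow> real \<Rightarrow> ('a \<Rightarrow> 'a \<Rightarrow> real) \<Rightarrow>
    'a multi_op \<Rightarrow> 'a multi_op" where
  "B_op \<Omega> k G T = (\<lambda>\<beta>s. potential \<Omega> k G (T (butlast \<beta>s)) (last \<beta>s))"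

text \<open>\<open>tensor l T T'\<close> is the product of \<open>T\<close>, of order \<open>l\<close>, with \<open>T'\<close>.\<close>

definition tensor :: "nat \<Rightarrow> 'a multi_op \<Rightarrow> 'a multi_op \<Rightarrow> 'a multi_op" where
  "tensor l T T' = (\<lambda>\<beta>s z. T (take l \<beta>s) z * T' (drop l \<beta>s) z)"

definition triples :: "nat \<Rightarrow> (nat \<times> nat \<times> nat) set" where
  "triples n = {(i1, i2, i3). i1 + i2 + i3 = n \<and> i1 \<le> n \<and> i2 \<le> n \<and> i3 \<le> n}"

function K_op :: "'a::euclidean_space set \<Rightarrow> real \<Rightarrow> ('a \<Rightarrow> 'a \<Rightarrow> real) \<Rightarrow>
    ('a \<times> 'a \<Rightarrow> real) \<Rightarrow> nat \<Rightarrow> 'a multi_op" where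
  "K_op \<Omega> k G u0 0 = (\<lambda>_. u0)"
| "K_op \<Omega> k G u0 (Suc n) = B_op \<Omega> k G (\<lambda>\<beta>s z.
     (\<Sum>(i1, i2, i3)\<in>triples n.
        tensor i1 (K_op \<Omega> k G u0 i1)
          (tensor i2 (K_op \<Omega> k G u0 i2) (K_op \<Omega> k G u0 i3)) \<beta>s z))"
  by pat_completeness auto
termination
  by (relation "Wellfounded.measure (\<lambda>(_, _, _, _, n). n)") (auto simp: triples_def)

definition forward_op :: "'a::euclidean_space set \<Rightarrow> real \<Rightarrow> ('a \<Rightarrow> 'a \<Rightarrow> real) \<Rightarrow>
    ('a \<times> 'a \<Rightarrow> real) \<Rightarrow> nat \<Rightarrow> 'a multi_op" where
  "forward_op \<Omega> k G u0 n \<beta>s = restrict (K_op \<Omega> k G u0 n \<beta>s) (frontier \<Omega> \<times> frontier \<Omega>)"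


section \<open>Inverse operators\<close>

text \<open>The tuples \<open>(i\<^sub>1, \<dots>, i\<^sub>n)\<close> of positive integers with sum \<open>m\<close>.\<close>

definition compositions :: "nat \<Rightarrow> nat \<Rightarrow> nat list set" where
  "compositions n m = {js. length js = n \<and> sum_list js = m \<and> (\<forall>j\<in>set js. 1 \<le> j)}"

lemma compositions_less:
  assumes "js \<in> compositions n m" "2 \<le> n" "j \<in> set js"
  shows "j < m"
proof -
  from assms(3) obtain xs ys where js: "js = xs @ j # ys"
    by (auto simp: in_set_conv_decomp)
  have "0 < sum_list (xs @ ys)"
  proof (cases "xs @ ys")
    case Nil
    with js assms show ?thesis by (auto simp: compositions_def)
  next
    case (Cons a zs)
    moreover have "1 \<le> a"
      using assms(1) js Cons by (cases xs) (auto simp: compositions_def)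
    ultimately show ?thesis by simp
  qed
  with js assms(1) show ?thesis by (auto simp: compositions_def)
qed

text \<open>\<open>inverse_op T F \<phi> m\<close> is \<open>\<K>\<^sub>m(\<phi>)\<close> with \<open>\<K>\<^sub>1 = T\<close> and forward operators \<open>F n\<close>.
  The value at \<open>m = 0\<close> is not used.\<close>

function inverse_op :: "(('a \<times> 'a \<Rightarrow> real) \<Rightarrow> ('a \<Rightarrow> real)) \<Rightarrow> (nat \<Rightarrow> 'a multi_op) \<Rightarrow>
    ('a \<times> 'a \<Rightarrow> real) \<Rightarrow> nat \<Rightarrow> 'a \<Rightarrow> real" where
  "inverse_op T F \<phi> m =
     (if m = 0 then (\<lambda>_. 0) else if m = 1 then T \<phi>
      else (\<lambda>x. - (\<Sum>n\<in>{2..m}. \<Sum>js\<in>compositions n m.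
                     T (F n (map (\<lambda>j. inverse_op T F \<phi> j) js)) x)))"
  by pat_completeness auto
termination
  by (relation "Wellfounded.measure (\<lambda>(_, _, _, m). m)") (auto dest: compositions_less)

declare inverse_op.simps [simp del]

end

theory Submission
  imports Defs
begin

text \<open>
  The series is compared with a scalar power series, in two stages. Write \<open>U = \<parallel>u\<^sub>0\<parallel>\<close> and
  \<open>\<kappa> = \<parallel>\<K>\<^sub>1\<parallel>\<close>.

  \<^emph>\<open>Forward operators.\<close> The potential satisfies
  \<open>\<parallel>b(v, \<beta>)\<parallel> \<le> \<mu> \<parallel>\<beta>\<parallel> \<parallel>v\<parallel>\<close> (\<open>potential_abs_le\<close>), so the norm of \<open>K\<^sub>n\<close> is at most \<open>a\<^sub>n\<close>, where
  \<open>a\<^sub>0 = U\<close> and \<open>a\<^sub>n\<^sub>+\<^sub>1 = \<mu> \<Sum> a\<^sub>i a\<^sub>j a\<^sub>l\<close> over \<open>i + j + l = n\<close>. The generating function \<open>A\<close> of this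
  sequence solves \<open>A = U + \<mu> t A\<^sup>3\<close>, an equation whose solution branches at
  \<open>t = 4 / (27 \<mu> U\<^sup>2)\<close> with value \<open>3 U / 2\<close>. With \<open>b = 27 \<mu> U\<^sup>2 / 4\<close> this gives
  \<open>a\<^sub>n \<le> (3 U / 2) b\<^sup>n\<close> (\<open>K_majorant_le_geometric\<close>).

  \<^emph>\<open>Inverse operators.\<close> Hence the norms \<open>N\<^sub>m\<close> of \<open>\<K>\<^sub>m(\<phi>)\<close> satisfy
  \<open>N\<^sub>m \<le> c \<Sum>\<^sub>n b\<^sup>n \<Sum> N\<^sub>i\<^sub>1 \<dots> N\<^sub>i\<^sub>n\<close> for \<open>m \<ge> 2\<close>, with \<open>c = 3 \<kappa> U / 2\<close> and the inner sum over the
  compositions of \<open>m\<close> into \<open>n \<ge> 2\<close> parts (\<open>inverse_op_norm_recurrence\<close>). Summing over \<open>m\<close>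
  turns the inner sums into \<open>n\<close>-th powers of partial sums, so the partial sums of \<open>\<Sum> N\<^sub>m\<close> stay below
  every \<open>\<rho>\<close> with \<open>N\<^sub>1 + c \<Sum>\<^sub>n\<^sub>\<ge>\<^sub>2 (b \<rho>)\<^sup>n \<le> \<rho>\<close>
  (\<open>partial_sums_of_composition_recurrence_bounded\<close>). Since \<open>c b = (81/8) \<mu> \<kappa> U\<^sup>3 \<le> C\<close> and
  \<open>b r = (\<surd>(16 C\<^sup>2 + 1) - 4 C) / 2 \<le> 1 / (16 C)\<close>, the choice \<open>b \<rho> = 1 / (4 C)\<close> works
  (\<open>inverse_radius_supersolution\<close>). The series is then absolutely convergent in the complete space
  \<open>L\<^sup>\<infinity>(\<Omega>)\<close>.

  One analytic point precedes all this. The constant \<open>\<mu>\<close> is a real supremum, so it bounds the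
  integrals of \<open>\<bar>G(x, y)\<bar>\<close> over \<open>y\<close> only once these are known to be bounded in \<open>x\<close>. The continuity of
  every potential on the compact set \<open>closure \<Omega> \<times> frontier \<Omega>\<close> says that the functionals
  \<open>\<beta> \<mapsto> \<integral> G(x, y) \<beta>(y) dy\<close> on \<open>L\<^sup>\<infinity>(\<Omega>)\<close> are pointwise bounded in \<open>x\<close>, and the principle of uniform
  boundedness (\<open>L1_norms_bounded_if_pairings_bounded\<close>) bounds their norms, which are these integrals.
\<close>

section \<open>The essential supremum norm\<close>

text \<open>The essential supremum of a nonnegative function is negative only on a null space, where it is
  \<open>- \<infinity>\<close>; there, and for non-measurable functions, the real value is \<open>0\<close> by convention.\<close>

lemma Linf_norm_nonneg: "0 \<le> Linf_norm \<Omega> \<beta>"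
proof (cases "(\<lambda>x. ereal \<bar>\<beta> x\<bar>) \<in> borel_measurable (lebesgue_on \<Omega>)")
  case True
  show ?thesis
  proof (cases "emeasure (lebesgue_on \<Omega>) (space (lebesgue_on \<Omega>)) = 0")
    case False
    then have "0 = esssup (lebesgue_on \<Omega>) (\<lambda>_. 0::ereal)"
      by (simp add: esssup_const)
    also have "\<dots> \<le> esssup (lebesgue_on \<Omega>) (\<lambda>x. ereal \<bar>\<beta> x\<bar>)"
      by (rule esssup_mono) auto
    finally show ?thesis
      by (simp add: Linf_norm_def real_of_ereal_pos)
  qed (use True in \<open>simp add: Linf_norm_def esssup_zero_space\<close>)
qed (simp add: Linf_norm_def esssup_non_measurable top_ereal_def)

lemma Linf_AE_le_norm:
  assumes "\<beta> \<in> Linf_space \<Omega>"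
  shows "AE x in lebesgue_on \<Omega>. \<bar>\<beta> x\<bar> \<le> Linf_norm \<Omega> \<beta>"
  using esssup_AE[of "\<lambda>x. ereal \<bar>\<beta> x\<bar>" "lebesgue_on \<Omega>"]
proof eventually_elim
  case (elim x)
  with assms show ?case
    unfolding Linf_norm_def Linf_space_def
    by (cases "esssup (lebesgue_on \<Omega>) (\<lambda>x. ereal \<bar>\<beta> x\<bar>)") auto
qed

lemma Linf_spaceI_norm_le:
  assumes "\<beta> \<in> borel_measurable (lebesgue_on \<Omega>)" "0 \<le> c"
    and "AE x in lebesgue_on \<Omega>. \<bar>\<beta> x\<bar> \<le> c"
  shows "\<beta> \<in> Linf_space \<Omega>" "Linf_norm \<Omega> \<beta> \<le> c"
proof -
  have *: "esssup (lebesgue_on \<Omega>) (\<lambda>x. ereal \<bar>\<beta> x\<bar>) \<le> ereal c"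
    using assms by (intro esssup_I) auto
  then show "\<beta> \<in> Linf_space \<Omega>"
    using assms(1) by (auto simp: Linf_space_def)
  from * \<open>0 \<le> c\<close> show "Linf_norm \<Omega> \<beta> \<le> c"
    unfolding Linf_norm_def
    by (cases "esssup (lebesgue_on \<Omega>) (\<lambda>x. ereal \<bar>\<beta> x\<bar>)") auto
qed

lemma Linf_measurable: "\<beta> \<in> Linf_space \<Omega> \<Longrightarrow> \<beta> \<in> borel_measurable (lebesgue_on \<Omega>)"
  by (simp add: Linf_space_def)

text \<open>A series in \<open>L\<^sup>\<infinity>(\<Omega>)\<close> whose norms are summable converges pointwise almost everywhere, and
  there the remainder after \<open>N\<close> terms is at most the tail of the series of norms, uniformly in
  the point.\<close>

lemma absolutely_convergent_series_converges_Linf: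
  assumes f: "\<And>m. 1 \<le> m \<Longrightarrow> f m \<in> Linf_space \<Omega>"
    and sm: "summable (\<lambda>m. Linf_norm \<Omega> (f (Suc m)))"
  shows "series_converges_Linf \<Omega> f"
proof -
  let ?M = "lebesgue_on \<Omega>" and ?a = "\<lambda>m. Linf_norm \<Omega> (f (Suc m))"
  define \<beta> where "\<beta> = (\<lambda>x. \<Sum>m. f (Suc m) x)"
  have meas[measurable]: "f (Suc m) \<in> borel_measurable ?M" for m
    using f by (simp add: Linf_measurable)
  have \<beta>_meas[measurable]: "\<beta> \<in> borel_measurable ?M"
    unfolding \<beta>_def by measurable
  have ae: "AE x in ?M. \<forall>m. \<bar>f (Suc m) x\<bar> \<le> ?a m"
    unfolding AE_all_countable using f by (auto intro: Linf_AE_le_norm)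
  have \<beta>_le: "AE x in ?M. \<bar>\<beta> x\<bar> \<le> suminf ?a"
    using ae
  proof eventually_elim
    case (elim x)
    have "norm (\<Sum>m. f (Suc m) x) \<le> suminf ?a"
      by (rule norm_suminf_le) (use elim sm in \<open>auto\<close>)
    then show ?case by (simp add: \<beta>_def)
  qed
  have \<beta>_Linf: "\<beta> \<in> Linf_space \<Omega>"
    by (rule Linf_spaceI_norm_le[OF _ _ \<beta>_le]) (auto intro: suminf_nonneg sm Linf_norm_nonneg)
  have tail: "Linf_norm \<Omega> (\<lambda>x. (\<Sum>m=1..N. f m x) - \<beta> x) \<le> (\<Sum>m. ?a (m + N))" for N
  proof (rule Linf_spaceI_norm_le(2))
    have eq: "(\<Sum>m=1..N. f m x) = (\<Sum>m<N. f (Suc m) x)" for x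
      using sum.shift_bounds_Suc_ivl[of "\<lambda>m. f m x" 0 N]
      by (simp add: atLeastLessThanSuc_atLeastAtMost lessThan_atLeast0)
    show "(\<lambda>x. (\<Sum>m=1..N. f m x) - \<beta> x) \<in> borel_measurable ?M"
      unfolding eq by measurable
    have smN: "summable (\<lambda>m. ?a (m + N))"
      using sm by (rule summable_ignore_initial_segment)
    then show "0 \<le> (\<Sum>m. ?a (m + N))"
      by (intro suminf_nonneg) (auto simp: Linf_norm_nonneg)
    show "AE x in ?M. \<bar>(\<Sum>m=1..N. f m x) - \<beta> x\<bar> \<le> (\<Sum>m. ?a (m + N))"
      using ae
    proof eventually_elim
      case (elim x)
      have smx: "summable (\<lambda>m. f (Suc m) x)"
        by (rule summable_comparison_test'[OF sm, of 0]) (use elim in auto)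
      have "\<beta> x - (\<Sum>m<N. f (Suc m) x) = (\<Sum>m. f (Suc (m + N)) x)"
        unfolding \<beta>_def using suminf_split_initial_segment[OF smx, of N] by simp
      moreover have "norm (\<Sum>m. f (Suc (m + N)) x) \<le> (\<Sum>m. ?a (m + N))"
        by (rule norm_suminf_le) (use elim smN in auto)
      ultimately show ?case unfolding eq by (simp add: abs_minus_commute)
    qed
  qed
  have "(\<lambda>N. \<Sum>m. ?a (m + N)) \<longlonglongrightarrow> 0"
    using sm suminf_exist_split2 by blast
  then have "(\<lambda>N. Linf_norm \<Omega> (\<lambda>x. (\<Sum>m=1..N. f m x) - \<beta> x)) \<longlonglongrightarrow> 0"
    by (rule Lim_null_comparison[rotated])
      (use tail in \<open>simp only: real_norm_def abs_of_nonneg[OF Linf_norm_nonneg] eventually_True\<close>)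
  with \<beta>_Linf show ?thesis
    unfolding series_converges_Linf_def by blast
qed


section \<open>Uniform boundedness for integral functionals\<close>

text \<open>The principle of uniform boundedness for functionals on bounded functions given by
  integration against integrable kernels, proved by a gliding hump in Sokal's form. If the
  \<open>L\<^sup>1\<close>-norms were unbounded, choose \<open>x n\<close> whose norm exceeds \<open>2 n 3\<^sup>n\<^sup>+\<^sup>1\<close> and build
  \<open>\<beta> = \<Sum> \<plusminus> 3\<^sup>-\<^sup>n\<^sup>-\<^sup>1 sgn (f (x n))\<close>, choosing the signs one after another so that the partial sum
  through index \<open>n\<close> pairs with \<open>f (x n)\<close> at least as strongly as its last term. The later terms
  add up to at most half the size of that term, so they cancel at most half of the pairing, and the
  pairings of \<open>\<beta>\<close> are unbounded.\<close>

lemma L1_norms_bounded_if_pairings_bounded: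
  fixes f :: "'i \<Rightarrow> 'b \<Rightarrow> real"
  assumes int: "\<And>x. x \<in> X \<Longrightarrow> integrable M (f x)"
    and pairing: "\<And>\<beta>. \<beta> \<in> borel_measurable M \<Longrightarrow> (\<And>y. \<bar>\<beta> y\<bar> \<le> 1) \<Longrightarrow>
      \<exists>B. \<forall>x\<in>X. \<bar>LINT y|M. f x y * \<beta> y\<bar> \<le> B"
  shows "\<exists>B. \<forall>x\<in>X. (LINT y|M. \<bar>f x y\<bar>) \<le> B"
proof (rule ccontr)
  assume "\<nexists>B. \<forall>x\<in>X. (LINT y|M. \<bar>f x y\<bar>) \<le> B"
  then have "\<forall>n. \<exists>x. x \<in> X \<and> 2 * 3 ^ Suc n * real n < (LINT y|M. \<bar>f x y\<bar>)"
    by (meson not_le)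
  then obtain x where x: "\<And>n. x n \<in> X"
    and large: "\<And>n. 2 * 3 ^ Suc n * real n < (LINT y|M. \<bar>f (x n) y\<bar>)"
    by metis
  define t :: "nat \<Rightarrow> real" where "t n = (1/3) ^ n" for n
  define h where "h n = f (x n)" for n
  have h_int: "integrable M (h n)" for n
    using int x by (simp add: h_def)
  then have h_meas[measurable]: "h n \<in> borel_measurable M" for n
    by (rule borel_measurable_integrable)
  have hb_int: "integrable M (\<lambda>y. h n y * b y)"
    if [measurable]: "b \<in> borel_measurable M" and b: "\<And>y. \<bar>b y\<bar> \<le> K" for b K n
  proof (rule Bochner_Integration.integrable_bound[of M "\<lambda>y. K * h n y"])
    show "AE y in M. norm (h n y * b y) \<le> norm (K * h n y)"
      using order_trans[OF b abs_ge_self]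
      by (auto simp: abs_mult mult.commute[of "\<bar>h n _\<bar>"] intro!: mult_right_mono)
  qed (use h_int in auto)
  let ?P = "\<lambda>n b. b \<in> borel_measurable M \<and> (\<forall>y. \<bar>b y\<bar> \<le> (1 - t n) / 2)"
  let ?Q = "\<lambda>n b b'. (\<forall>y. \<bar>b' y - b y\<bar> \<le> t (Suc n)) \<and>
      t (Suc n) * (LINT y|M. \<bar>h n y\<bar>) \<le> \<bar>LINT y|M. h n y * b' y\<bar>"
  have "\<exists>b. \<forall>n. ?P n (b n) \<and> ?Q n (b n) (b (Suc n))"
  proof (rule dependent_nat_choice)
    show "\<exists>b. ?P 0 b"
      by (rule exI[of _ "\<lambda>_. 0"]) (simp add: t_def)
  next
    fix b n assume b: "?P n b"
    then have [measurable]: "b \<in> borel_measurable M" by simp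
    \<comment> \<open>Of \<open>b + s\<close> and \<open>b - s\<close>, where \<open>s\<close> is a multiple of the sign of \<open>h n\<close>, at least one pairs
      strongly with \<open>h n\<close>, because the two pairings differ by twice the pairing of \<open>s\<close>.\<close>
    define s where "s = (\<lambda>y. t (Suc n) * sgn (h n y))"
    have [measurable]: "s \<in> borel_measurable M" unfolding s_def by measurable
    have tpos: "0 < t (Suc n)" "t n = 3 * t (Suc n)" by (auto simp: t_def)
    then have s_le: "\<bar>s y\<bar> \<le> t (Suc n)" for y
      by (auto simp: s_def abs_mult sgn_if)
    have bs: "\<bar>b y\<bar> + \<bar>s y\<bar> \<le> (1 - t (Suc n)) / 2" for y
      using spec[OF conjunct2[OF b], of y] s_le[of y] tpos(2) by argo
    have P: "?P (Suc n) (\<lambda>y. b y + s y)" "?P (Suc n) (\<lambda>y. b y - s y)"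
      using order_trans[OF abs_triangle_ineq bs] order_trans[OF abs_triangle_ineq4 bs] by auto
    have Q: "\<bar>(b y + s y) - b y\<bar> \<le> t (Suc n)" "\<bar>(b y - s y) - b y\<bar> \<le> t (Suc n)" for y
      using s_le by auto
    have "(LINT y|M. h n y * (b y + s y)) - (LINT y|M. h n y * (b y - s y))
        = (LINT y|M. h n y * (b y + s y) - h n y * (b y - s y))"
      using P by (intro Bochner_Integration.integral_diff[symmetric]
          hb_int[where K = "(1 - t (Suc n)) / 2"]) blast+
    also have "\<dots> = (LINT y|M. (2 * t (Suc n)) * \<bar>h n y\<bar>)"
      by (intro Bochner_Integration.integral_cong) (auto simp: s_def algebra_simps abs_sgn)
    also have "\<dots> = 2 * t (Suc n) * (LINT y|M. \<bar>h n y\<bar>)" by simp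
    finally have "t (Suc n) * (LINT y|M. \<bar>h n y\<bar>) \<le> \<bar>LINT y|M. h n y * (b y + s y)\<bar> \<or>
        t (Suc n) * (LINT y|M. \<bar>h n y\<bar>) \<le> \<bar>LINT y|M. h n y * (b y - s y)\<bar>"
      by linarith
    then show "\<exists>b'. ?P (Suc n) b' \<and> ?Q n b b'"
      using P Q by blast
  qed
  then obtain b where b_meas[measurable]: "\<And>n. b n \<in> borel_measurable M"
    and b_le: "\<And>n y. \<bar>b n y\<bar> \<le> (1 - t n) / 2"
    and b_step: "\<And>n y. \<bar>b (Suc n) y - b n y\<bar> \<le> t (Suc n)"
    and b_pair: "\<And>n. t (Suc n) * (LINT y|M. \<bar>h n y\<bar>) \<le> \<bar>LINT y|M. h n y * b (Suc n) y\<bar>"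
    by blast
  have t_pos: "0 < t n" for n by (simp add: t_def)
  have b_dist: "\<bar>b (n + d) y - b n y\<bar> \<le> (t n - t (n + d)) / 2" for n d y
  proof (induction d)
    case (Suc d)
    have "\<bar>b (n + Suc d) y - b n y\<bar>
        \<le> \<bar>b (Suc (n + d)) y - b (n + d) y\<bar> + \<bar>b (n + d) y - b n y\<bar>"
      by simp
    also have "\<dots> \<le> t (Suc (n + d)) + (t n - t (n + d)) / 2"
      using Suc b_step by (rule add_mono[rotated])
    also have "\<dots> = (t n - t (n + Suc d)) / 2"
      by (simp add: t_def field_simps)
    finally show ?case .
  qed simp
  define \<beta> where "\<beta> y = lim (\<lambda>n. b n y)" for y
  have lim: "(\<lambda>n. b n y) \<longlonglongrightarrow> \<beta> y" for y
  proof -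
    have "summable (\<lambda>n. b (Suc n) y - b n y)"
      by (rule summable_comparison_test'[of "\<lambda>n. t (Suc n)" 0])
         (use b_step in \<open>auto simp: t_def intro!: summable_mult summable_geometric\<close>)
    then have "convergent (\<lambda>n. b n y)"
      by (simp add: summable_iff_convergent sum_lessThan_telescope[of "\<lambda>n. b n y"]
          convergent_diff_const_right_iff)
    then show ?thesis unfolding \<beta>_def by (simp add: convergent_LIMSEQ_iff)
  qed
  have \<beta>_meas[measurable]: "\<beta> \<in> borel_measurable M"
    unfolding \<beta>_def by measurable
  have \<beta>_le: "\<bar>\<beta> y\<bar> \<le> 1" for y
  proof (rule LIMSEQ_le_const2[OF tendsto_rabs[OF lim]])
    have "\<bar>b n y\<bar> \<le> 1" for n
      using b_le[of n y] t_pos[of n] by argo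
    then show "\<exists>N. \<forall>n\<ge>N. \<bar>b n y\<bar> \<le> 1" by blast
  qed
  have \<beta>_dist: "\<bar>\<beta> y - b n y\<bar> \<le> t n / 2" for n y
  proof (rule LIMSEQ_le_const2)
    show "(\<lambda>d. \<bar>b (d + n) y - b n y\<bar>) \<longlonglongrightarrow> \<bar>\<beta> y - b n y\<bar>"
      by (intro tendsto_intros LIMSEQ_ignore_initial_segment lim)
    show "\<exists>N. \<forall>d\<ge>N. \<bar>b (d + n) y - b n y\<bar> \<le> t n / 2"
    proof (intro exI allI impI)
      fix d show "\<bar>b (d + n) y - b n y\<bar> \<le> t n / 2"
        using b_dist[of n d y] t_pos[of "n + d"] by (simp add: add.commute)
    qed
  qed
  obtain B where B: "\<And>x. x \<in> X \<Longrightarrow> \<bar>LINT y|M. f x y * \<beta> y\<bar> \<le> B"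
    using pairing[OF \<beta>_meas \<beta>_le] by blast
  obtain n where n: "B < real n" using reals_Archimedean2 by blast
  let ?L = "LINT y|M. \<bar>h n y\<bar>" and ?t = "t (Suc n)"
  have "\<bar>(LINT y|M. h n y * \<beta> y) - (LINT y|M. h n y * b (Suc n) y)\<bar>
      = \<bar>LINT y|M. h n y * (\<beta> y - b (Suc n) y)\<bar>"
    using hb_int[OF \<beta>_meas \<beta>_le] hb_int[OF b_meas b_le, of n "Suc n"]
    by (simp add: right_diff_distrib)
  also have "\<dots> \<le> (LINT y|M. \<bar>h n y * (\<beta> y - b (Suc n) y)\<bar>)"
    by (rule integral_abs_bound)
  also have "\<dots> \<le> (LINT y|M. \<bar>h n y\<bar> * (?t / 2))"
  proof (rule Bochner_Integration.integral_mono)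
    show "integrable M (\<lambda>y. \<bar>h n y * (\<beta> y - b (Suc n) y)\<bar>)"
      by (intro integrable_abs hb_int[OF _ \<beta>_dist]) measurable
    show "\<bar>h n y * (\<beta> y - b (Suc n) y)\<bar> \<le> \<bar>h n y\<bar> * (?t / 2)" for y
      unfolding abs_mult by (rule mult_left_mono[OF \<beta>_dist abs_ge_zero])
  qed (use h_int[of n] in auto)
  also have "\<dots> = ?t / 2 * ?L" by simp
  finally have "?t / 2 * ?L \<le> \<bar>LINT y|M. h n y * \<beta> y\<bar>"
    using b_pair[of n]
      abs_triangle_ineq2_sym[of "LINT y|M. h n y * b (Suc n) y" "LINT y|M. h n y * \<beta> y"]
    by (simp add: field_simps)
  also have "\<dots> \<le> B" using B[OF x[of n]] by (simp add: h_def)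
  finally have "?t / 2 * ?L \<le> B" .
  moreover have "real n < ?t / 2 * ?L"
    using large[of n] by (simp add: t_def h_def field_simps power_divide)
  ultimately show False using n by linarith
qed


section \<open>Continuous functions on compact sets and bounded operators\<close>

lemma abs_le_C_norm:
  assumes "compact S" "f \<in> C_space S" "z \<in> S"
  shows "\<bar>f z\<bar> \<le> C_norm S f"
proof -
  have "compact ((\<lambda>z. \<bar>f z\<bar>) ` S)"
    using assms by (intro compact_continuous_image continuous_intros) (auto simp: C_space_def)
  then have "bdd_above ((\<lambda>z. \<bar>f z\<bar>) ` S)"
    by (intro bounded_imp_bdd_above compact_imp_bounded)
  with assms(3) show ?thesis
    unfolding C_norm_def by (rule cSUP_upper)
qed

lemma C_norm_le: "S \<noteq> {} \<Longrightarrow> (\<And>z. z \<in> S \<Longrightarrow> \<bar>f z\<bar> \<le> c) \<Longrightarrow> C_norm S f \<le> c"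
  unfolding C_norm_def by (rule cSUP_least)

lemma C_norm_nonneg:
  assumes "compact S" "S \<noteq> {}" "f \<in> C_space S"
  shows "0 \<le> C_norm S f"
  using assms abs_le_C_norm[OF assms(1,3)] by (meson abs_ge_zero equals0I order_trans)

text \<open>The operator norm is a supremum over the unit ball, so boundedness of \<open>T\<close> is what makes it an
  upper bound there; homogeneity of \<open>T\<close>, which holds only almost everywhere, extends it to all \<open>f\<close>.
  When \<open>f\<close> vanishes on \<open>S\<close> it cannot be rescaled to the unit sphere, and boundedness gives the
  claim directly.\<close>

lemma op_norm_bound:
  assumes S: "compact S" "S \<noteq> {}" and T: "bounded_linear_C_Linf S \<Omega> T"
  shows "0 \<le> op_norm S \<Omega> T"
    and "f \<in> C_space S \<Longrightarrow> Linf_norm \<Omega> (T f) \<le> op_norm S \<Omega> T * C_norm S f"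
proof -
  obtain M where M: "\<And>f. f \<in> C_space S \<Longrightarrow> Linf_norm \<Omega> (T f) \<le> M * C_norm S f"
    using T unfolding bounded_linear_C_Linf_def by blast
  have "Linf_norm \<Omega> (T f) \<le> \<bar>M\<bar>" if "f \<in> C_space S" "C_norm S f \<le> 1" for f
  proof -
    have "M * C_norm S f \<le> \<bar>M\<bar> * 1"
      using that C_norm_nonneg[OF S that(1)] by (intro mult_mono) auto
    with M[OF that(1)] show ?thesis by simp
  qed
  then have bdd: "bdd_above ((\<lambda>f. Linf_norm \<Omega> (T f)) ` {f \<in> C_space S. C_norm S f \<le> 1})"
    by (intro bdd_aboveI2) auto
  have unit: "Linf_norm \<Omega> (T f) \<le> op_norm S \<Omega> T" if "f \<in> C_space S" "C_norm S f \<le> 1" for f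
    unfolding op_norm_def by (rule cSUP_upper[OF _ bdd]) (use that in simp)
  have "C_norm S (\<lambda>_. 0) \<le> 1"
    using S(2) by (intro C_norm_le) auto
  then show nonneg: "0 \<le> op_norm S \<Omega> T"
    using unit[of "\<lambda>_. 0"] Linf_norm_nonneg[of \<Omega> "T (\<lambda>_. 0)"] by (simp add: C_space_def)
  show "Linf_norm \<Omega> (T f) \<le> op_norm S \<Omega> T * C_norm S f" if f: "f \<in> C_space S"
  proof (cases "C_norm S f = 0")
    case True
    with M[OF f] show ?thesis by simp
  next
    case False
    define c where "c = C_norm S f"
    have c: "0 < c" using False C_norm_nonneg[OF S f] by (simp add: c_def)
    let ?h = "\<lambda>z. (1 / c) * f z"
    have h: "?h \<in> C_space S"
      using f unfolding C_space_def mem_Collect_eq by (intro continuous_intros)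
    have "C_norm S ?h \<le> 1"
      using S c abs_le_C_norm[OF S(1) f] by (intro C_norm_le) (auto simp: abs_mult c_def field_simps)
    then have le: "Linf_norm \<Omega> (T ?h) \<le> op_norm S \<Omega> T"
      using h by (intro unit)
    have mem: "T f \<in> Linf_space \<Omega>" "T ?h \<in> Linf_space \<Omega>"
      using T f h unfolding bounded_linear_C_Linf_def by blast+
    have "AE x in lebesgue_on \<Omega>. T ?h x = (1 / c) * T f x"
      using T f unfolding bounded_linear_C_Linf_def by blast
    then have "AE x in lebesgue_on \<Omega>. \<bar>T f x\<bar> \<le> c * Linf_norm \<Omega> (T ?h)"
      using Linf_AE_le_norm[OF mem(2)]
    proof eventually_elim
      case (elim x)
      then have "T f x = c * T ?h x" using c by simp
      with elim(2) c show ?case by (simp add: abs_mult)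
    qed
    then have "Linf_norm \<Omega> (T f) \<le> c * Linf_norm \<Omega> (T ?h)"
      using c mem(1) by (intro Linf_spaceI_norm_le(2)) (auto simp: Linf_norm_nonneg Linf_measurable)
    also have "\<dots> \<le> op_norm S \<Omega> T * C_norm S f"
      using le c by (simp add: c_def mult.commute)
    finally show ?thesis .
  qed
qed


section \<open>The potential\<close>

lemma potential_abs_le_interior:
  assumes \<Omega>: "open \<Omega>" and G: "integrable (lebesgue_on \<Omega>) (G x)" and s: "s \<in> frontier \<Omega>"
    and v: "v \<in> C_space (closure \<Omega> \<times> frontier \<Omega>)" and \<beta>: "\<beta> \<in> Linf_space \<Omega>"
    and V: "\<And>z. z \<in> closure \<Omega> \<times> frontier \<Omega> \<Longrightarrow> \<bar>v z\<bar> \<le> V"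
  shows "\<bar>potential \<Omega> k G v \<beta> (x, s)\<bar>
    \<le> k\<^sup>2 * (LINT y|lebesgue_on \<Omega>. \<bar>G x y\<bar>) * (Linf_norm \<Omega> \<beta> * V)"
proof -
  let ?M = "lebesgue_on \<Omega>" and ?N = "Linf_norm \<Omega> \<beta>"
  have \<Omega>_meas: "\<Omega> \<in> sets lebesgue" using \<Omega> by auto
  have "continuous_on \<Omega> (\<lambda>y. v (y, s))"
    using v s closure_subset[of \<Omega>] unfolding C_space_def
    by (auto intro!: continuous_on_compose2[of "closure \<Omega> \<times> frontier \<Omega>" v] continuous_intros)
  then have [measurable]: "(\<lambda>y. v (y, s)) \<in> borel_measurable ?M"
    using \<Omega>_meas by (rule continuous_imp_measurable_on_sets_lebesgue)
  have [measurable]: "\<beta> \<in> borel_measurable ?M" "G x \<in> borel_measurable ?M"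
    using \<beta> G by (auto intro: Linf_measurable)
  have bd: "AE y in ?M. \<bar>G x y * \<beta> y * v (y, s)\<bar> \<le> \<bar>G x y\<bar> * (?N * V)"
    using Linf_AE_le_norm[OF \<beta>] AE_space
  proof eventually_elim
    case (elim y)
    then have "y \<in> closure \<Omega>" using closure_subset by auto
    with s have "\<bar>v (y, s)\<bar> \<le> V" by (intro V) auto
    with elim(1) have "\<bar>\<beta> y\<bar> * \<bar>v (y, s)\<bar> \<le> ?N * V"
      by (intro mult_mono) (auto simp: Linf_norm_nonneg)
    then show ?case
      by (simp add: abs_mult mult.assoc mult_left_mono)
  qed
  have int: "integrable ?M (\<lambda>y. \<bar>G x y\<bar> * (?N * V))"
    using G by simp
  have int': "integrable ?M (\<lambda>y. G x y * \<beta> y * v (y, s))"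
    by (rule Bochner_Integration.integrable_bound[OF int]) (use bd in auto)
  have "\<bar>LINT y|?M. G x y * \<beta> y * v (y, s)\<bar> \<le> (LINT y|?M. \<bar>G x y * \<beta> y * v (y, s)\<bar>)"
    by (rule integral_abs_bound)
  also have "\<dots> \<le> (LINT y|?M. \<bar>G x y\<bar> * (?N * V))"
    using int' int bd by (intro integral_mono_AE) auto
  also have "\<dots> = (LINT y|?M. \<bar>G x y\<bar>) * (?N * V)" by simp
  finally show ?thesis
    unfolding potential_def by (simp add: abs_mult mult.assoc mult_left_mono)
qed

text \<open>The supremum \<open>\<mu>\<close> runs over \<open>\<Omega>\<close> only. At boundary points, where the forward operators are
  finally evaluated, the bound follows from the continuity of the potential up to the boundary.\<close>

lemma potential_abs_le:
  assumes \<Omega>: "open \<Omega>"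
    and G: "\<And>x. x \<in> closure \<Omega> \<Longrightarrow> integrable (lebesgue_on \<Omega>) (G x)"
    and \<mu>: "\<And>x. x \<in> \<Omega> \<Longrightarrow> k\<^sup>2 * (LINT y|lebesgue_on \<Omega>. \<bar>G x y\<bar>) \<le> \<mu>"
    and cont: "potential \<Omega> k G v \<beta> \<in> C_space (closure \<Omega> \<times> frontier \<Omega>)"
    and v: "v \<in> C_space (closure \<Omega> \<times> frontier \<Omega>)" and \<beta>: "\<beta> \<in> Linf_space \<Omega>"
    and V: "\<And>z. z \<in> closure \<Omega> \<times> frontier \<Omega> \<Longrightarrow> \<bar>v z\<bar> \<le> V"
    and z: "z \<in> closure \<Omega> \<times> frontier \<Omega>"
  shows "\<bar>potential \<Omega> k G v \<beta> z\<bar> \<le> \<mu> * (Linf_norm \<Omega> \<beta> * V)"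
proof -
  obtain x s where z_eq: "z = (x, s)" and x: "x \<in> closure \<Omega>" and s: "s \<in> frontier \<Omega>"
    using z by blast
  have V0: "0 \<le> V" using V[OF z] by linarith
  have "continuous_on (closure \<Omega>) (\<lambda>x. \<bar>potential \<Omega> k G v \<beta> (x, s)\<bar>)"
    using cont s unfolding C_space_def
    by (auto intro!: continuous_intros
        continuous_on_compose2[of "closure \<Omega> \<times> frontier \<Omega>" "potential \<Omega> k G v \<beta>"])
  then show ?thesis
    unfolding z_eq using x
  proof (rule continuous_le_on_closure)
    fix x assume x: "x \<in> \<Omega>"
    then have "x \<in> closure \<Omega>" using closure_subset by auto
    then have "\<bar>potential \<Omega> k G v \<beta> (x, s)\<bar>
        \<le> k\<^sup>2 * (LINT y|lebesgue_on \<Omega>. \<bar>G x y\<bar>) * (Linf_norm \<Omega> \<beta> * V)"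
      by (intro potential_abs_le_interior \<Omega> G s v \<beta> V)
    also have "\<dots> \<le> \<mu> * (Linf_norm \<Omega> \<beta> * V)"
      using \<mu>[OF x] V0 by (intro mult_right_mono) (auto simp: Linf_norm_nonneg)
    finally show "\<bar>potential \<Omega> k G v \<beta> (x, s)\<bar> \<le> \<mu> * (Linf_norm \<Omega> \<beta> * V)" .
  qed
qed

text \<open>Testing the continuity of potentials with \<open>v = 1\<close> bounds the pairings of \<open>G x\<close> with each bounded
  \<open>\<beta>\<close> uniformly in \<open>x\<close>, which is the hypothesis of the principle of uniform boundedness.\<close>

lemma green_L1_norms_bdd_above:
  assumes \<Omega>: "compact (closure \<Omega>)" "compact (frontier \<Omega>)" "frontier \<Omega> \<noteq> {}" and k: "k \<noteq> 0"
    and G: "\<And>x. x \<in> closure \<Omega> \<Longrightarrow> integrable (lebesgue_on \<Omega>) (G x)"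
    and cont: "\<And>v \<beta>. v \<in> C_space (closure \<Omega> \<times> frontier \<Omega>) \<Longrightarrow> \<beta> \<in> Linf_space \<Omega> \<Longrightarrow>
      potential \<Omega> k G v \<beta> \<in> C_space (closure \<Omega> \<times> frontier \<Omega>)"
  shows "bdd_above ((\<lambda>x. LINT y|lebesgue_on \<Omega>. \<bar>G x y\<bar>) ` \<Omega>)"
proof -
  obtain s where s: "s \<in> frontier \<Omega>" using \<Omega>(3) by blast
  have "\<exists>B. \<forall>x\<in>closure \<Omega>. (LINT y|lebesgue_on \<Omega>. \<bar>G x y\<bar>) \<le> B"
  proof (rule L1_norms_bounded_if_pairings_bounded)
    fix \<beta> :: "'a \<Rightarrow> real"
    assume "\<beta> \<in> borel_measurable (lebesgue_on \<Omega>)" "\<And>y. \<bar>\<beta> y\<bar> \<le> 1"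
    then have "\<beta> \<in> Linf_space \<Omega>" by (intro Linf_spaceI_norm_le(1)[of _ _ 1]) auto
    then have p: "potential \<Omega> k G (\<lambda>_. 1) \<beta> \<in> C_space (closure \<Omega> \<times> frontier \<Omega>)"
      by (intro cont) (auto simp: C_space_def)
    let ?P = "C_norm (closure \<Omega> \<times> frontier \<Omega>) (potential \<Omega> k G (\<lambda>_. 1) \<beta>)"
    have "\<bar>LINT y|lebesgue_on \<Omega>. G x y * \<beta> y\<bar> \<le> ?P / k\<^sup>2" if "x \<in> closure \<Omega>" for x
    proof -
      have "\<bar>potential \<Omega> k G (\<lambda>_. 1) \<beta> (x, s)\<bar> \<le> ?P"
        using that s \<Omega> by (intro abs_le_C_norm[OF _ p] compact_Times) auto
      then show ?thesis
        using k by (simp add: potential_def abs_mult field_simps)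
    qed
    then show "\<exists>B. \<forall>x\<in>closure \<Omega>. \<bar>LINT y|lebesgue_on \<Omega>. G x y * \<beta> y\<bar> \<le> B" by blast
  qed (rule G)
  then obtain B where "\<And>x. x \<in> closure \<Omega> \<Longrightarrow> (LINT y|lebesgue_on \<Omega>. \<bar>G x y\<bar>) \<le> B" by blast
  then show ?thesis
    by (intro bdd_aboveI2) (use closure_subset in blast)
qed


section \<open>Bounds for the forward operators\<close>

function K_majorant :: "real \<Rightarrow> real \<Rightarrow> nat \<Rightarrow> real" where
  "K_majorant \<mu> U 0 = U"
| "K_majorant \<mu> U (Suc n) = \<mu> * (\<Sum>(i1, i2, i3)\<in>triples n.
      K_majorant \<mu> U i1 * (K_majorant \<mu> U i2 * K_majorant \<mu> U i3))"
  by pat_completeness auto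
termination
  by (relation "Wellfounded.measure (\<lambda>(_, _, n). n)") (auto simp: triples_def)

lemma K_majorant_nonneg: "0 \<le> \<mu> \<Longrightarrow> 0 \<le> U \<Longrightarrow> 0 \<le> K_majorant \<mu> U n"
proof (induction n rule: less_induct)
  case (less n)
  show ?case
  proof (cases n)
    case (Suc m)
    then show ?thesis
      using less by (auto intro!: mult_nonneg_nonneg sum_nonneg simp: triples_def)
  qed (use less in simp)
qed

lemma finite_triples: "finite (triples n)"
  by (rule finite_subset[of _ "{..n} \<times> {..n} \<times> {..n}"]) (auto simp: triples_def)

text \<open>The left-hand side expands to those terms of the cube whose indices have sum at most \<open>N\<close>.\<close>

lemma sum_triples_le_cube:
  fixes f :: "nat \<Rightarrow> real"
  assumes "\<And>i. 0 \<le> f i"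
  shows "(\<Sum>n\<le>N. \<Sum>(i1, i2, i3)\<in>triples n. f i1 * (f i2 * f i3)) \<le> (\<Sum>i\<le>N. f i) ^ 3"
proof -
  let ?p = "\<lambda>(i1, i2, i3). f i1 * (f i2 * f i3)"
  have "(\<Sum>n\<le>N. sum ?p (triples n)) = sum ?p (\<Union>n\<le>N. triples n)"
    by (rule sum.UNION_disjoint[symmetric]) (use finite_triples in \<open>auto simp: triples_def\<close>)
  also have "\<dots> \<le> sum ?p ({..N} \<times> {..N} \<times> {..N})"
    using assms by (intro sum_mono2) (auto simp: triples_def)
  also have "\<dots> = (\<Sum>i\<le>N. f i) ^ 3"
    by (simp add: sum.cartesian_product[symmetric] power3_eq_cube mult.assoc
        flip: sum_distrib_left sum_distrib_right)
  finally show ?thesis .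
qed

text \<open>At \<open>t = 4 / (27 \<mu> U\<^sup>2)\<close> the partial sums of the generating function are nondecreasing and the map
  \<open>s \<mapsto> U + \<mu> t s\<^sup>3\<close>, which dominates the passage from one to the next, has the fixed point
  \<open>3 U / 2\<close>. No larger \<open>t\<close> admits a positive fixed point, so the rate \<open>1 / t\<close> is optimal for this argument.\<close>

lemma K_majorant_le_geometric:
  assumes \<mu>: "0 < \<mu>" and U: "0 < U"
  shows "K_majorant \<mu> U n \<le> 3 / 2 * U * (27 * \<mu> * U\<^sup>2 / 4) ^ n"
proof -
  define t where "t = 4 / (27 * \<mu> * U\<^sup>2)"
  have t: "0 < t" using \<mu> U by (simp add: t_def)
  define a where "a i = K_majorant \<mu> U i * t ^ i" for i
  have a_nonneg: "0 \<le> a i" for i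
    using \<mu> U t by (simp add: a_def K_majorant_nonneg)
  have a_Suc: "a (Suc i) = \<mu> * t * (\<Sum>(i1, i2, i3)\<in>triples i. a i1 * (a i2 * a i3))" for i
  proof -
    have "a (Suc i) = \<mu> * t * (\<Sum>(i1, i2, i3)\<in>triples i.
        K_majorant \<mu> U i1 * (K_majorant \<mu> U i2 * K_majorant \<mu> U i3) * t ^ i)"
      by (simp add: a_def sum_distrib_right[symmetric] case_prod_beta)
    also have "(\<Sum>(i1, i2, i3)\<in>triples i.
        K_majorant \<mu> U i1 * (K_majorant \<mu> U i2 * K_majorant \<mu> U i3) * t ^ i)
        = (\<Sum>(i1, i2, i3)\<in>triples i. a i1 * (a i2 * a i3))"
      by (intro sum.cong) (auto simp: triples_def a_def power_add)
    finally show ?thesis .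
  qed
  have sum_le: "(\<Sum>i\<le>N. a i) \<le> 3 / 2 * U" for N
  proof (induction N)
    case 0
    show ?case using U by (simp add: a_def)
  next
    case (Suc N)
    have "(\<Sum>i\<le>Suc N. a i) = U + \<mu> * t * (\<Sum>i\<le>N. \<Sum>(i1, i2, i3)\<in>triples i. a i1 * (a i2 * a i3))"
      unfolding sum.atMost_Suc_shift a_Suc sum_distrib_left[symmetric] by (simp add: a_def)
    also have "\<dots> \<le> U + \<mu> * t * (\<Sum>i\<le>N. a i) ^ 3"
      using \<mu> t a_nonneg by (intro add_left_mono mult_left_mono sum_triples_le_cube) auto
    also have "\<dots> \<le> U + \<mu> * t * (3 / 2 * U) ^ 3"
      using \<mu> t a_nonneg Suc.IH by (intro add_left_mono mult_left_mono power_mono sum_nonneg) auto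
    also have "\<dots> = 3 / 2 * U"
      using \<mu> U by (simp add: t_def power2_eq_square power3_eq_cube field_simps)
    finally show ?case .
  qed
  have "a n \<le> (\<Sum>i\<le>n. a i)"
    using a_nonneg by (intro member_le_sum) auto
  also note sum_le
  finally have "K_majorant \<mu> U n \<le> 3 / 2 * U * (1 / t) ^ n"
    using t by (simp add: a_def field_simps)
  then show ?thesis by (simp add: t_def)
qed

text \<open>The operators obey the recursion that defines \<open>K_majorant\<close>, with norms in place of the factors.
  Continuity has to be carried through the same induction, since both the continuity and the bound
  of a potential presuppose that its argument \<open>v\<close> is continuous.\<close>

lemma K_op_continuous_and_bounded:
  fixes \<Omega> :: "'a::euclidean_space set" and G :: "'a \<Rightarrow> 'a \<Rightarrow> real" and k U \<mu> :: real
  defines "S \<equiv> closure \<Omega> \<times> frontier \<Omega>"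
  assumes cont: "\<And>v \<beta>. v \<in> C_space S \<Longrightarrow> \<beta> \<in> Linf_space \<Omega> \<Longrightarrow> potential \<Omega> k G v \<beta> \<in> C_space S"
    and bound: "\<And>v \<beta> V z. v \<in> C_space S \<Longrightarrow> \<beta> \<in> Linf_space \<Omega> \<Longrightarrow>
      (\<And>z. z \<in> S \<Longrightarrow> \<bar>v z\<bar> \<le> V) \<Longrightarrow> z \<in> S \<Longrightarrow>
      \<bar>potential \<Omega> k G v \<beta> z\<bar> \<le> \<mu> * (Linf_norm \<Omega> \<beta> * V)"
    and u0: "u0 \<in> C_space S" "\<And>z. z \<in> S \<Longrightarrow> \<bar>u0 z\<bar> \<le> U"
    and pos: "0 \<le> \<mu>" "0 \<le> U"
    and \<beta>s: "length \<beta>s = n" "set \<beta>s \<subseteq> Linf_space \<Omega>"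
  shows "K_op \<Omega> k G u0 n \<beta>s \<in> C_space S \<and>
    (\<forall>z\<in>S. \<bar>K_op \<Omega> k G u0 n \<beta>s z\<bar> \<le> K_majorant \<mu> U n * prod_list (map (Linf_norm \<Omega>) \<beta>s))"
  using \<beta>s
proof (induction n arbitrary: \<beta>s rule: less_induct)
  case (less n)
  let ?K = "K_op \<Omega> k G u0" and ?a = "K_majorant \<mu> U"
  let ?P = "\<lambda>\<beta>s. prod_list (map (Linf_norm \<Omega>) \<beta>s)"
  show ?case
  proof (cases n)
    case 0
    with less.prems u0 show ?thesis by auto
  next
    case (Suc m)
    then obtain \<gamma>s \<beta> where \<beta>s_eq: "\<beta>s = \<gamma>s @ [\<beta>]" and len: "length \<gamma>s = m"
      using less.prems(1) by (metis length_Suc_conv_rev)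
    have \<gamma>s: "set \<gamma>s \<subseteq> Linf_space \<Omega>" and \<beta>: "\<beta> \<in> Linf_space \<Omega>"
      using less.prems(2) \<beta>s_eq by auto
    define v where "v = (\<lambda>z. \<Sum>(i1, i2, i3)\<in>triples m.
        tensor i1 (?K i1) (tensor i2 (?K i2) (?K i3)) \<gamma>s z)"
    have K_eq: "?K n \<beta>s = potential \<Omega> k G v \<beta>"
      by (simp add: Suc \<beta>s_eq B_op_def v_def)
    have summand: "tensor i1 (?K i1) (tensor i2 (?K i2) (?K i3)) \<gamma>s \<in> C_space S \<and>
        (\<forall>z\<in>S. \<bar>tensor i1 (?K i1) (tensor i2 (?K i2) (?K i3)) \<gamma>s z\<bar>
          \<le> ?a i1 * (?a i2 * ?a i3) * ?P \<gamma>s)"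
      if "(i1, i2, i3) \<in> triples m" for i1 i2 i3
    proof -
      let ?x = "take i1 \<gamma>s" and ?y = "take i2 (drop i1 \<gamma>s)" and ?w = "drop i2 (drop i1 \<gamma>s)"
      have lens: "length ?x = i1" "length ?y = i2" "length ?w = i3" and lt: "i1 < n" "i2 < n" "i3 < n"
        using that len Suc by (auto simp: triples_def)
      have sets: "set ?x \<subseteq> Linf_space \<Omega>" "set ?y \<subseteq> Linf_space \<Omega>" "set ?w \<subseteq> Linf_space \<Omega>"
        using \<gamma>s by (meson order_trans set_take_subset set_drop_subset)+
      note IH = less.IH[OF lt(1) lens(1) sets(1)] less.IH[OF lt(2) lens(2) sets(2)]
        less.IH[OF lt(3) lens(3) sets(3)]
      have split: "?P \<gamma>s = ?P ?x * (?P ?y * ?P ?w)"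
        by (metis append_take_drop_id map_append prod_list.append)
      have P_nonneg: "0 \<le> ?P l" for l :: "('a \<Rightarrow> real) list"
        by (rule prod_list_nonneg) (auto simp: Linf_norm_nonneg)
      have "tensor i1 (?K i1) (tensor i2 (?K i2) (?K i3)) \<gamma>s \<in> C_space S"
        using IH unfolding tensor_def C_space_def by (auto intro!: continuous_intros)
      moreover have "\<bar>tensor i1 (?K i1) (tensor i2 (?K i2) (?K i3)) \<gamma>s z\<bar>
          \<le> ?a i1 * (?a i2 * ?a i3) * ?P \<gamma>s" if "z \<in> S" for z
      proof -
        have "\<bar>?K i1 ?x z\<bar> * (\<bar>?K i2 ?y z\<bar> * \<bar>?K i3 ?w z\<bar>)
            \<le> (?a i1 * ?P ?x) * ((?a i2 * ?P ?y) * (?a i3 * ?P ?w))"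
          using IH that pos by (intro mult_mono mult_nonneg_nonneg K_majorant_nonneg P_nonneg) auto
        then show ?thesis
          unfolding tensor_def abs_mult split by (simp add: mult_ac)
      qed
      ultimately show ?thesis by blast
    qed
    have v_cont: "v \<in> C_space S"
      using summand unfolding v_def C_space_def
      by (auto intro!: continuous_on_sum simp: case_prod_beta)
    have v_le: "\<bar>v z\<bar> \<le> (\<Sum>(i1, i2, i3)\<in>triples m. ?a i1 * (?a i2 * ?a i3)) * ?P \<gamma>s"
      if "z \<in> S" for z
    proof -
      have "\<bar>v z\<bar> \<le> (\<Sum>(i1, i2, i3)\<in>triples m. ?a i1 * (?a i2 * ?a i3) * ?P \<gamma>s)"
        unfolding v_def using summand that
        by (intro order_trans[OF sum_abs] sum_mono) auto
      then show ?thesis by (simp add: sum_distrib_right case_prod_beta)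
    qed
    have "\<bar>?K n \<beta>s z\<bar> \<le> ?a n * ?P \<beta>s" if "z \<in> S" for z
      using bound[OF v_cont \<beta> v_le that] unfolding K_eq by (simp add: Suc \<beta>s_eq mult_ac)
    then show ?thesis
      using cont[OF v_cont \<beta>] unfolding K_eq by blast
  qed
qed


section \<open>The majorant of the inverse series\<close>

lemma finite_compositions: "finite (compositions n m)"
proof (rule finite_subset)
  show "compositions n m \<subseteq> {js. set js \<subseteq> {..m} \<and> length js = n}"
    by (auto simp: compositions_def member_le_sum_list)
qed (simp add: finite_lists_length_eq)

text \<open>Expanding the \<open>n\<close>-th power of a sum gives one product for each list of \<open>n\<close> indices.\<close>

lemma sum_prod_list_lists:
  fixes f :: "'b \<Rightarrow> 'c::comm_semiring_1"
  assumes "finite A"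
  shows "(\<Sum>js | set js \<subseteq> A \<and> length js = n. prod_list (map f js)) = sum f A ^ n"
proof (induction n)
  case 0
  have "{js. set js \<subseteq> A \<and> length js = 0} = {[]}" by auto
  then show ?case by simp
next
  case (Suc n)
  let ?L = "{js. set js \<subseteq> A \<and> length js = n}"
  have "(\<Sum>js | set js \<subseteq> A \<and> length js = Suc n. prod_list (map f js))
      = (\<Sum>(js, j)\<in>?L \<times> A. prod_list (map f (j # js)))"
    unfolding lists_length_Suc_eq
    by (subst sum.reindex) (auto simp: inj_on_def case_prod_beta)
  also have "\<dots> = sum f A * (\<Sum>js\<in>?L. prod_list (map f js))"
    by (simp add: sum.cartesian_product[symmetric] mult.commute
        flip: sum_distrib_left sum_distrib_right)
  finally show ?case using Suc by simp
qed

text \<open>A composition of \<open>m \<le> M + 1\<close> into at least two parts has all its parts at most \<open>M\<close>, and distinct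
  \<open>m\<close> have distinct compositions, so each product on the left occurs in the expansion of the power.
  That the power involves \<open>M\<close> and not \<open>M + 1\<close> is what makes the induction below possible.\<close>

lemma sum_compositions_le_power:
  fixes N :: "nat \<Rightarrow> real"
  assumes N: "\<And>m. 0 \<le> N m" and n: "2 \<le> n"
  shows "(\<Sum>m=2..Suc M. \<Sum>js\<in>compositions n m. prod_list (map N js)) \<le> (\<Sum>m=1..M. N m) ^ n"
proof -
  let ?p = "\<lambda>js. prod_list (map N js)" and ?L = "{js. set js \<subseteq> {1..M} \<and> length js = n}"
  have "(\<Sum>m=2..Suc M. sum ?p (compositions n m)) = sum ?p (\<Union>m\<in>{2..Suc M}. compositions n m)"
    by (rule sum.UNION_disjoint[symmetric])
      (use finite_compositions in \<open>auto simp: compositions_def\<close>)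
  also have "\<dots> \<le> sum ?p ?L"
  proof (rule sum_mono2)
    show "(\<Union>m\<in>{2..Suc M}. compositions n m) \<subseteq> ?L"
    proof
      fix js assume "js \<in> (\<Union>m\<in>{2..Suc M}. compositions n m)"
      then obtain m where m: "m \<le> Suc M" "js \<in> compositions n m" by auto
      then have "j \<in> {1..M}" if "j \<in> set js" for j
        using that compositions_less[OF m(2) n that] by (auto simp: compositions_def)
      then show "js \<in> ?L" using m by (auto simp: compositions_def)
    qed
  qed (use N in \<open>auto simp: finite_lists_length_eq intro!: prod_list_nonneg\<close>)
  also have "\<dots> = (\<Sum>m=1..M. N m) ^ n"
    by (rule sum_prod_list_lists) simp
  finally show ?thesis .
qed

text \<open>If \<open>s\<^sub>M\<close> is the \<open>M\<close>-th partial sum of \<open>N\<close>, the recurrence gives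
  \<open>s\<^sub>M\<^sub>+\<^sub>1 \<le> x + c \<Sum>\<^sub>n\<^sub>\<ge>\<^sub>2 (b s\<^sub>M)\<^sup>n\<close>. The right-hand side increases with \<open>s\<^sub>M\<close>, so an upper bound \<open>\<rho>\<close> that
  it maps below itself persists.\<close>

lemma partial_sums_of_composition_recurrence_bounded:
  fixes N :: "nat \<Rightarrow> real"
  assumes N: "\<And>m. 0 \<le> N m" and c: "0 \<le> c" and b: "0 \<le> b" and \<rho>: "0 \<le> \<rho>" "b * \<rho> < 1"
    and first: "N 1 \<le> x"
    and rec: "\<And>m. 2 \<le> m \<Longrightarrow>
      N m \<le> (\<Sum>n=2..m. c * b ^ n * (\<Sum>js\<in>compositions n m. prod_list (map N js)))"
    and supersolution: "x + c * ((b * \<rho>)\<^sup>2 / (1 - b * \<rho>)) \<le> \<rho>"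
  shows "(\<Sum>m=1..M. N m) \<le> \<rho>"
proof (induction M)
  case (Suc M)
  let ?S = "\<lambda>n m. \<Sum>js\<in>compositions n m. prod_list (map N js)" and ?w = "b * \<rho>"
  have S_nonneg: "0 \<le> ?S n m" for n m
    using N by (auto intro!: sum_nonneg prod_list_nonneg)
  have w: "0 \<le> ?w" using b \<rho> by simp
  have "(\<Sum>m=2..Suc M. N m) \<le> (\<Sum>m=2..Suc M. \<Sum>n=2..m. c * b ^ n * ?S n m)"
    by (intro sum_mono rec) simp
  also have "\<dots> \<le> (\<Sum>m=2..Suc M. \<Sum>n=2..Suc M. c * b ^ n * ?S n m)"
    by (intro sum_mono sum_mono2) (use b c S_nonneg in auto)
  also have "\<dots> = (\<Sum>n=2..Suc M. c * b ^ n * (\<Sum>m=2..Suc M. ?S n m))"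
    unfolding sum_distrib_left by (rule sum.swap)
  also have "\<dots> \<le> (\<Sum>n=2..Suc M. c * b ^ n * \<rho> ^ n)"
  proof (intro sum_mono mult_left_mono)
    fix n assume "n \<in> {2..Suc M}"
    then have "(\<Sum>m=2..Suc M. ?S n m) \<le> (\<Sum>m=1..M. N m) ^ n"
      by (intro sum_compositions_le_power N) simp
    also have "\<dots> \<le> \<rho> ^ n"
      by (intro power_mono Suc.IH sum_nonneg N)
    finally show "(\<Sum>m=2..Suc M. ?S n m) \<le> \<rho> ^ n" .
  qed (use b c in auto)
  also have "\<dots> = c * (\<Sum>n=2..Suc M. ?w ^ n)"
    by (simp add: sum_distrib_left power_mult_distrib mult.assoc del: sum.cl_ivl_Suc)
  also have "\<dots> \<le> c * (?w\<^sup>2 / (1 - ?w))"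
  proof (intro mult_left_mono c)
    have "(1 - ?w) * (\<Sum>n=2..Suc M. ?w ^ n) \<le> ?w\<^sup>2"
      using w by (cases M) (simp_all add: sum_gp_multiplied del: sum.cl_ivl_Suc)
    then show "(\<Sum>n=2..Suc M. ?w ^ n) \<le> ?w\<^sup>2 / (1 - ?w)"
      using \<rho>(2) by (simp add: pos_le_divide_eq mult.commute)
  qed
  finally have "(\<Sum>m=2..Suc M. N m) \<le> c * (?w\<^sup>2 / (1 - ?w))" .
  moreover have "(\<Sum>m=1..Suc M. N m) = N 1 + (\<Sum>m=2..Suc M. N m)"
    by (subst sum.atLeast_Suc_atMost) (auto simp: numeral_2_eq_2)
  ultimately show ?case using first supersolution by linarith
qed (use \<rho> in simp)

text \<open>With \<open>w = b \<rho>\<close> the condition reads \<open>b x + c b w\<^sup>2 / (1 - w) \<le> w\<close>. The bound on \<open>x\<close> gives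
  \<open>b x \<le> 1 / (16 C)\<close>, and for \<open>w = 1 / (4 C) \<le> 1 / 8\<close> the second term is at most
  \<open>(8 / 7) C w\<^sup>2 = 1 / (14 C)\<close>; the two together are less than \<open>1 / (4 C)\<close>.\<close>

lemma inverse_radius_supersolution:
  fixes b c C x :: real
  assumes b: "0 < b" and c: "0 \<le> c" and C: "2 \<le> C" "c * b \<le> C"
    and x: "x \<le> (sqrt (16 * C\<^sup>2 + 1) - 4 * C) / (2 * b)"
  defines "\<rho> \<equiv> 1 / (4 * C * b)"
  shows "0 \<le> \<rho>" "b * \<rho> < 1" "x + c * ((b * \<rho>)\<^sup>2 / (1 - b * \<rho>)) \<le> \<rho>"
proof -
  have w: "b * \<rho> = 1 / (4 * C)" and Cpos: "0 < C"
    using b C by (auto simp: \<rho>_def)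
  show "0 \<le> \<rho>" using b Cpos by (simp add: \<rho>_def)
  show "b * \<rho> < 1" unfolding w using C by simp
  have "16 * C\<^sup>2 + 1 \<le> (4 * C + 1 / (8 * C))\<^sup>2"
    using Cpos by (simp add: power2_eq_square field_simps)
  then have "sqrt (16 * C\<^sup>2 + 1) \<le> 4 * C + 1 / (8 * C)"
    using Cpos by (intro real_le_lsqrt) auto
  moreover have "b * x \<le> (sqrt (16 * C\<^sup>2 + 1) - 4 * C) / 2"
    using x b by (simp add: field_simps)
  ultimately have bx: "b * x \<le> 1 / (16 * C)" by (simp add: field_simps)
  have "1 / (1 - 1 / (4 * C)) \<le> 8 / 7"
    using C by (simp add: field_simps)
  then have "(1 / (4 * C))\<^sup>2 * (1 / (1 - 1 / (4 * C))) \<le> (1 / (4 * C))\<^sup>2 * (8 / 7)"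
    by (intro mult_left_mono) auto
  then have "(c * b) * ((1 / (4 * C))\<^sup>2 / (1 - 1 / (4 * C))) \<le> C * ((1 / (4 * C))\<^sup>2 * (8 / 7))"
    using C b c by (intro mult_mono) auto
  also have "\<dots> = 1 / (14 * C)"
    using Cpos by (simp add: power2_eq_square field_simps)
  finally have "b * x + (c * b) * ((1 / (4 * C))\<^sup>2 / (1 - 1 / (4 * C))) \<le> 1 / (16 * C) + 1 / (14 * C)"
    by (rule add_mono[OF bx])
  also have "1 / (16 * C) + 1 / (14 * C) \<le> b * \<rho>"
    unfolding w using Cpos by (simp add: field_simps)
  finally have "b * (x + c * ((b * \<rho>)\<^sup>2 / (1 - b * \<rho>))) \<le> b * \<rho>"
    unfolding w by (simp add: distrib_left mult_ac)
  then show "x + c * ((b * \<rho>)\<^sup>2 / (1 - b * \<rho>)) \<le> \<rho>"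
    using b by (simp only: mult_le_cancel_left_pos)
qed


section \<open>Norms of the inverse operators\<close>

text \<open>Only finitely many terms enter each \<open>\<K>\<^sub>m(\<phi>)\<close>, so their almost-everywhere bounds hold
  simultaneously outside one null set. Membership in \<open>L\<^sup>\<infinity>(\<Omega>)\<close> is needed for all smaller indices
  before the bounds on the forward operators apply, hence the strong induction.\<close>

lemma inverse_op_norm_recurrence:
  assumes S: "compact S" "S \<noteq> {}" and T: "bounded_linear_C_Linf S \<Omega> T"
    and \<phi>: "\<phi> \<in> C_space S"
    and F: "\<And>n \<beta>s. length \<beta>s = n \<Longrightarrow> set \<beta>s \<subseteq> Linf_space \<Omega> \<Longrightarrow> F n \<beta>s \<in> C_space S"
    and F_le: "\<And>n \<beta>s. length \<beta>s = n \<Longrightarrow> set \<beta>s \<subseteq> Linf_space \<Omega> \<Longrightarrow>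
      C_norm S (F n \<beta>s) \<le> d n * prod_list (map (Linf_norm \<Omega>) \<beta>s)"
  defines "N \<equiv> \<lambda>m. Linf_norm \<Omega> (inverse_op T F \<phi> m)"
  shows "inverse_op T F \<phi> m \<in> Linf_space \<Omega>"
    and "2 \<le> m \<Longrightarrow> N m \<le> (\<Sum>n=2..m. op_norm S \<Omega> T * d n *
      (\<Sum>js\<in>compositions n m. prod_list (map N js)))"
proof -
  let ?I = "inverse_op T F \<phi>"
  have "?I m \<in> Linf_space \<Omega> \<and> (2 \<le> m \<longrightarrow> N m \<le> (\<Sum>n=2..m. op_norm S \<Omega> T * d n *
      (\<Sum>js\<in>compositions n m. prod_list (map N js))))"
  proof (induction m rule: less_induct)
    case (less m)
    consider "m = 0" | "m = 1" | "2 \<le> m" by linarith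
    then show ?case
    proof cases
      case 1
      then have "?I m = (\<lambda>_. 0)" by (simp add: inverse_op.simps)
      then show ?thesis
        using 1 Linf_spaceI_norm_le(1)[of "\<lambda>_. 0" \<Omega> 0] by simp
    next
      case 2
      then have "?I m = T \<phi>" by (simp add: inverse_op.simps)
      then show ?thesis using 2 T \<phi> by (auto simp: bounded_linear_C_Linf_def)
    next
      case 3
      let ?t = "\<lambda>n js. T (F n (map ?I js))"
      have I_eq: "?I m = (\<lambda>x. - (\<Sum>n\<in>{2..m}. \<Sum>js\<in>compositions n m. ?t n js x))"
        using 3 by (subst inverse_op.simps) simp
      let ?b = "\<lambda>n js. op_norm S \<Omega> T * (d n * prod_list (map N js))"
      have t: "?t n js \<in> Linf_space \<Omega>" "Linf_norm \<Omega> (?t n js) \<le> ?b n js"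
        if n: "n \<in> {2..m}" and js: "js \<in> compositions n m" for n js
      proof -
        have len: "length (map ?I js) = n" and mem: "set (map ?I js) \<subseteq> Linf_space \<Omega>"
          using n js less.IH compositions_less[OF js] by (auto simp: compositions_def)
        note F' = F[OF len mem]
        show "?t n js \<in> Linf_space \<Omega>"
          using T F' by (auto simp: bounded_linear_C_Linf_def)
        have "Linf_norm \<Omega> (?t n js) \<le> op_norm S \<Omega> T * C_norm S (F n (map ?I js))"
          by (rule op_norm_bound(2)[OF S T F'])
        also have "\<dots> \<le> ?b n js"
          using F_le[OF len mem] op_norm_bound(1)[OF S T]
          by (intro mult_left_mono) (auto simp: N_def comp_def)
        finally show "Linf_norm \<Omega> (?t n js) \<le> ?b n js" .
      qed
      have b_nonneg: "0 \<le> ?b n js" if "n \<in> {2..m}" "js \<in> compositions n m" for n js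
        using t(2)[OF that] Linf_norm_nonneg order_trans by blast
      have "AE x in lebesgue_on \<Omega>. \<forall>n\<in>{2..m}. \<forall>js\<in>compositions n m. \<bar>?t n js x\<bar> \<le> ?b n js"
      proof (intro AE_finite_allI finite_compositions)
        fix n js assume nj: "n \<in> {2..m}" "js \<in> compositions n m"
        show "AE x in lebesgue_on \<Omega>. \<bar>?t n js x\<bar> \<le> ?b n js"
          using Linf_AE_le_norm[OF t(1)[OF nj]] t(2)[OF nj] by (auto elim!: eventually_mono)
      qed simp
      then have ae: "AE x in lebesgue_on \<Omega>. \<bar>?I m x\<bar> \<le> (\<Sum>n=2..m. \<Sum>js\<in>compositions n m. ?b n js)"
      proof eventually_elim
        case (elim x)
        have "\<bar>\<Sum>n=2..m. \<Sum>js\<in>compositions n m. ?t n js x\<bar> \<le> (\<Sum>n=2..m. \<Sum>js\<in>compositions n m. ?b n js)"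
          using elim by (intro order_trans[OF sum_abs] sum_mono) blast
        then show ?case by (simp add: I_eq)
      qed
      have meas: "?I m \<in> borel_measurable (lebesgue_on \<Omega>)"
        unfolding I_eq by (intro borel_measurable_uminus borel_measurable_sum Linf_measurable t(1))
      have nonneg: "0 \<le> (\<Sum>n=2..m. \<Sum>js\<in>compositions n m. ?b n js)"
        using b_nonneg by (intro sum_nonneg) auto
      from Linf_spaceI_norm_le[OF meas nonneg ae] show ?thesis
        by (simp add: N_def sum_distrib_left mult.assoc)
    qed
  qed
  then show "?I m \<in> Linf_space \<Omega>"
    and "2 \<le> m \<Longrightarrow> N m \<le> (\<Sum>n=2..m. op_norm S \<Omega> T * d n *
      (\<Sum>js\<in>compositions n m. prod_list (map N js)))"
    by auto
qed

section \<open>Convergence of the inverse Born series\<close>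

theorem theorem1:
  fixes \<Omega> :: "'a::euclidean_space set" and k :: real
    and G :: "'a \<Rightarrow> 'a \<Rightarrow> real"
    and g :: "'a \<Rightarrow> 'a \<Rightarrow> real"
    and u0 :: "'a \<times> 'a \<Rightarrow> real"
    and T1 :: "('a \<times> 'a \<Rightarrow> real) \<Rightarrow> ('a \<Rightarrow> real)"
    and \<phi> :: "'a \<times> 'a \<Rightarrow> real"
    and \<mu> C r :: real
  assumes dim: "DIM('a) \<ge> 2"
    and domain: "smooth_bounded_domain \<Omega>"
    and non_eigenvalue: "\<not> neumann_eigenvalue \<Omega> (- k\<^sup>2)"
    and green: "neumann_green \<Omega> k G"
    and green_integrable: "\<And>x. x \<in> closure \<Omega> \<Longrightarrow> integrable (lebesgue_on \<Omega>) (G x)"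
    and potential_continuous: "\<And>v \<beta>. v \<in> C_space (closure \<Omega> \<times> frontier \<Omega>) \<Longrightarrow>
          \<beta> \<in> Linf_space \<Omega> \<Longrightarrow> potential \<Omega> k G v \<beta> \<in> C_space (closure \<Omega> \<times> frontier \<Omega>)"
    and u0_continuous: "u0 \<in> C_space (closure \<Omega> \<times> frontier \<Omega>)"
    and u0_solution: "\<And>s. s \<in> frontier \<Omega> \<Longrightarrow> neumann_solution \<Omega> (- k\<^sup>2) (g s) (\<lambda>x. u0 (x, s))"
    and u0_nonzero: "\<exists>z \<in> closure \<Omega> \<times> frontier \<Omega>. u0 z \<noteq> 0"
    and T1: "bounded_linear_C_Linf (frontier \<Omega> \<times> frontier \<Omega>) \<Omega> T1"
    and phi: "\<phi> \<in> C_space (frontier \<Omega> \<times> frontier \<Omega>)"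
    and mu_def: "\<mu> = k\<^sup>2 * (SUP x\<in>\<Omega>. LINT y|lebesgue_on \<Omega>. \<bar>G x y\<bar>)"
    and C_def: "C = max 2 (81 / 8 * \<mu> * op_norm (frontier \<Omega> \<times> frontier \<Omega>) \<Omega> T1
                            * C_norm (closure \<Omega> \<times> frontier \<Omega>) u0 ^ 3)"
    and r_def: "r = 2 / (27 * \<mu> * (C_norm (closure \<Omega> \<times> frontier \<Omega>) u0)\<^sup>2)
                      * (sqrt (16 * C\<^sup>2 + 1) - 4 * C)"
    and small: "Linf_norm \<Omega> (T1 \<phi>) < r"
  shows "series_converges_Linf \<Omega> (inverse_op T1 (forward_op \<Omega> k G u0) \<phi>)"
proof -
  let ?S = "closure \<Omega> \<times> frontier \<Omega>" and ?D = "frontier \<Omega> \<times> frontier \<Omega>"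
  define U where "U = C_norm ?S u0"
  define \<kappa> where "\<kappa> = op_norm ?D \<Omega> T1"
  have \<Omega>: "open \<Omega>" "bounded \<Omega>" "\<Omega> \<noteq> {}"
    using domain by (auto simp: smooth_bounded_domain_def)
  have compact: "compact (closure \<Omega>)" "compact (frontier \<Omega>)"
    using \<Omega> by (auto simp: compact_closure compact_frontier_bounded)
  have frontier_ne: "frontier \<Omega> \<noteq> {}" using u0_nonzero by auto
  have D: "compact ?D" "?D \<noteq> {}" and S: "compact ?S"
    using compact frontier_ne by (auto intro: compact_Times)
  have D_sub: "?D \<subseteq> ?S" by (auto simp: frontier_def)

  have u0_le: "\<bar>u0 z\<bar> \<le> U" if "z \<in> ?S" for z
    unfolding U_def by (rule abs_le_C_norm[OF S u0_continuous that])
  have U: "0 < U"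
    using u0_nonzero u0_le by (force intro: less_le_trans)

  \<comment> \<open>For \<open>\<mu> = 0\<close> the division by zero in \<open>r\<close> yields \<open>r = 0\<close>, which no norm is below.\<close>
  have "\<mu> \<noteq> 0"
    using small Linf_norm_nonneg[of \<Omega> "T1 \<phi>"] by (auto simp: r_def)
  then have k: "k \<noteq> 0" by (auto simp: mu_def)
  have bdd: "bdd_above ((\<lambda>x. LINT y|lebesgue_on \<Omega>. \<bar>G x y\<bar>) ` \<Omega>)"
    by (rule green_L1_norms_bdd_above[OF compact frontier_ne k])
      (use green_integrable potential_continuous in auto)
  have \<mu>_ge: "k\<^sup>2 * (LINT y|lebesgue_on \<Omega>. \<bar>G x y\<bar>) \<le> \<mu>" if "x \<in> \<Omega>" for x
    unfolding mu_def by (intro mult_left_mono cSUP_upper that bdd) auto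
  have \<mu>: "0 < \<mu>"
  proof -
    obtain x where "x \<in> \<Omega>" using \<Omega>(3) by blast
    from \<mu>_ge[OF this] have "0 \<le> \<mu>"
      by (rule order_trans[rotated]) simp
    with \<open>\<mu> \<noteq> 0\<close> show ?thesis by simp
  qed

  define b where "b = 27 * \<mu> * U\<^sup>2 / 4"
  define c where "c = \<kappa> * (3 / 2 * U)"
  have b: "0 < b" using \<mu> U by (simp add: b_def)
  have \<kappa>: "0 \<le> \<kappa>" unfolding \<kappa>_def by (rule op_norm_bound(1)[OF D T1])
  have c: "0 \<le> c" using \<kappa> U by (simp add: c_def)

  have pot: "\<bar>potential \<Omega> k G v \<beta> z\<bar> \<le> \<mu> * (Linf_norm \<Omega> \<beta> * V)"
    if "v \<in> C_space ?S" "\<beta> \<in> Linf_space \<Omega>" "\<And>z. z \<in> ?S \<Longrightarrow> \<bar>v z\<bar> \<le> V" "z \<in> ?S" for v \<beta> V z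
    by (rule potential_abs_le[OF \<Omega>(1) green_integrable \<mu>_ge potential_continuous])
      (use that in auto)
  have K: "K_op \<Omega> k G u0 n \<beta>s \<in> C_space ?S \<and> (\<forall>z\<in>?S. \<bar>K_op \<Omega> k G u0 n \<beta>s z\<bar>
      \<le> K_majorant \<mu> U n * prod_list (map (Linf_norm \<Omega>) \<beta>s))"
    if "length \<beta>s = n" "set \<beta>s \<subseteq> Linf_space \<Omega>" for n \<beta>s
    by (rule K_op_continuous_and_bounded)
      (use potential_continuous pot u0_continuous u0_le \<mu> U that in auto)
  let ?F = "forward_op \<Omega> k G u0"
  have F_cont: "?F n \<beta>s \<in> C_space ?D" if "length \<beta>s = n" "set \<beta>s \<subseteq> Linf_space \<Omega>" for n \<beta>s
  proof -
    have "continuous_on ?D (K_op \<Omega> k G u0 n \<beta>s)"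
      using K[OF that] D_sub by (auto simp: C_space_def intro: continuous_on_subset)
    then show ?thesis
      by (simp add: C_space_def forward_op_def cong: continuous_on_cong)
  qed
  have F_le: "C_norm ?D (?F n \<beta>s) \<le> 3 / 2 * U * b ^ n * prod_list (map (Linf_norm \<Omega>) \<beta>s)"
    if \<beta>s: "length \<beta>s = n" "set \<beta>s \<subseteq> Linf_space \<Omega>" for n \<beta>s
  proof (rule C_norm_le[OF D(2)])
    fix z assume z: "z \<in> ?D"
    have P: "0 \<le> prod_list (map (Linf_norm \<Omega>) \<beta>s)"
      by (rule prod_list_nonneg) (auto simp: Linf_norm_nonneg)
    have "\<bar>?F n \<beta>s z\<bar> \<le> K_majorant \<mu> U n * prod_list (map (Linf_norm \<Omega>) \<beta>s)"
      using K[OF \<beta>s] z D_sub by (auto simp: forward_op_def)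
    also have "\<dots> \<le> 3 / 2 * U * b ^ n * prod_list (map (Linf_norm \<Omega>) \<beta>s)"
      unfolding b_def by (intro mult_right_mono K_majorant_le_geometric \<mu> U P)
    finally show "\<bar>?F n \<beta>s z\<bar> \<le> 3 / 2 * U * b ^ n * prod_list (map (Linf_norm \<Omega>) \<beta>s)" .
  qed

  let ?N = "\<lambda>m. Linf_norm \<Omega> (inverse_op T1 ?F \<phi> m)"
  have inv_Linf: "inverse_op T1 ?F \<phi> m \<in> Linf_space \<Omega>" for m
    by (rule inverse_op_norm_recurrence(1)[OF D T1 phi F_cont F_le])
  have rec: "?N m \<le> (\<Sum>n=2..m. c * b ^ n * (\<Sum>js\<in>compositions n m. prod_list (map ?N js)))"
    if "2 \<le> m" for m
    using inverse_op_norm_recurrence(2)[OF D T1 phi F_cont F_le that]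
    by (simp add: c_def \<kappa>_def mult_ac)
  have first: "?N 1 \<le> (sqrt (16 * C\<^sup>2 + 1) - 4 * C) / (2 * b)"
  proof -
    have "r = (sqrt (16 * C\<^sup>2 + 1) - 4 * C) / (2 * b)"
      by (simp add: r_def b_def U_def algebra_simps)
    with small show ?thesis by (simp add: inverse_op.simps)
  qed
  have "2 \<le> C" "c * b \<le> C"
    by (auto simp: C_def c_def b_def U_def \<kappa>_def power2_eq_square power3_eq_cube mult_ac)
  then have super: "0 \<le> 1 / (4 * C * b)" "b * (1 / (4 * C * b)) < 1"
      "?N 1 + c * ((b * (1 / (4 * C * b)))\<^sup>2 / (1 - b * (1 / (4 * C * b)))) \<le> 1 / (4 * C * b)"
    using inverse_radius_supersolution[OF b c _ _ first] by blast+
  have "(\<Sum>m=1..M. ?N m) \<le> 1 / (4 * C * b)" for M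
    by (rule partial_sums_of_composition_recurrence_bounded[OF Linf_norm_nonneg c less_imp_le[OF b]
          super(1,2) order_refl rec super(3)])
  moreover have "(\<Sum>m=1..M. ?N m) = (\<Sum>m<M. ?N (Suc m))" for M
    using sum.shift_bounds_Suc_ivl[of ?N 0 M]
    by (simp add: atLeastLessThanSuc_atLeastAtMost lessThan_atLeast0)
  ultimately have "(\<Sum>m<M. ?N (Suc m)) \<le> 1 / (4 * C * b)" for M
    by metis
  then have "summable (\<lambda>m. ?N (Suc m))"
    by (intro summableI_nonneg_bounded Linf_norm_nonneg)
  then show ?thesis
    using inv_Linf by (intro absolutely_convergent_series_converges_Linf)
qed
end
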